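(* Let $P$, the transition matrix of an absorbing Markov chain restricted to its finite set $\mathcal{T}$ of transient states as in the context, be $(\sigma,\kappa)$-reversible with invariant $K$ (in the canonical normalization). Then $$C^*=\frac{1}{1+\sqrt K}$$ is a universal invariant: it depends only on $K$, not on $\gamma$, not on the specific reset distribution, and not on the choice of chain within the class. Here $K=\kappa(z)\kappa(\sigma(z))$ is evaluated in the canonical normalization.
   Context: Setting. A Markov chain lives on a finite set $\mathcal{T}\cup\partial_0\cup\partial_1$ (disjoint union); $\mathcal{T}$ consists of transient states, $\partial_0\cup\partial_1$ is the absorbing boundary, the restriction of the chain to $\mathcal{T}$ is irreducible, and absorption is certain from every state of $\mathcal{T}$. $P=(P_{z,w})_{z,w\in\mathcal{T}}$ is the restricted transition matrix (spectral radius $<1$), and $R(\gamma)=(I-(1-\gamma)P)^{-1}$, where $\gamma\in(0,1)$ is the resetting rate. The boundary fluxes are $b^{(0)}_x=\sum_{y\in\partial_0}P_{xy}$, $b^{(1)}_x=\sum_{y\in\partial_1}P_{xy}$, $b=b^{(0)}+b^{(1)}$. $(\sigma,\kappa)$-reversibility. Let $\sigma:\mathcal{T}\to\mathcal{T}$ be an involution ($\sigma\circ\sigma=\mathrm{id}$) and $\kappa:\mathcal{T}\to(0,\infty)$ a weight. $P$ is $(\sigma,\kappa)$-reversible if $P_{z,w}=\dfrac{\kappa(z)}{\kappa(w)}P_{\sigma(z),\sigma(w)}$ for all $z,w\in\mathcal{T}$. The class referred to is the class of $(\sigma,\kappa)$-reversible chains. Standing assumptions. $P$ is diagonalizable (complete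 set of eigenvectors); $\kappa(z)\kappa(\sigma(z))=K$ is constant in $z$; and the boundary fluxes are compatible: $b^{(1)}_z=\kappa(z)\,b^{(0)}_{\sigma(z)}$ for all $z\in\mathcal{T}$. Canonical normalization. Reversibility involves only ratios of $\kappa$, whereas replacing $\kappa$ by $c\kappa$ replaces $K$ by $c^2K$; the scale is fixed by the symmetrizing factor: with $\Delta=\operatorname{diag}(\Delta_{zz})$ positive diagonal such that $\Delta^{-1}P\Delta$ is symmetric, one sets $\kappa(z)=\Delta_{zz}^2$. For the biased random walk on $\{0,\dots,a\}$ (step $+1$ with probability $p$, step $-1$ with probability $q$, absorbing states $0$ and $a$, $\sigma(z)=a-z$) the canonical normalization is $\kappa(z)=(p/q)^{a-z}$, giving $K=(p/q)^a$; the same $\kappa(z)=(p/q)^{a-z}$ is the canonical normalization used for nearest-neighbor chains with $\sigma(z)=a-z$. Critical value. For a reset distribution $\pi$ (a probability distribution on $\mathcal{T}$), $C(\pi,\gamma)=\langle\pi,R(\gamma)b^{(0)}\rangle/\langle\pi,R(\gamma)b\rangle$, with $\langle\pi,v\rangle=\sum_z\pi_zv_z$. $C^*$ denotes the critical value of this coupling, i.e. the value $C(\pi^*,\gamma)=C^*$ taken at reset-neutral distributions $\pi^*$, such as, for any $z$, the distribution on $\{z,\sigma(z)\}$ with $\pi^*_z/\pi^*_{\sigma(z)}=\sqrt{\kappa(\sigma(z))}/\sqrt{\kappa(z)}$ (the point mass at $z$ if $\sigma(z)=z$). *)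

theory Defs
  imports "HOL-Analysis.Analysis" "HOL-Probability.Probability_Mass_Function"
begin

datatype ('t, 'd0, 'd1) state = Transient 't | Boundary0 'd0 | Boundary1 'd1

type_synonym ('t, 'd0, 'd1) kernel = "('t, 'd0, 'd1) state \<Rightarrow> ('t, 'd0, 'd1) state pmf"

primrec nstep :: "('t, 'd0, 'd1) kernel \<Rightarrow> nat \<Rightarrow> ('t, 'd0, 'd1) kernel" where
  "nstep Q 0 x = return_pmf x"
| "nstep Q (Suc n) x = bind_pmf (nstep Q n x) Q"

definition restricted_matrix :: "('t::finite, 'd0, 'd1) kernel \<Rightarrow> real ^ 't ^ 't" where
  "restricted_matrix Q = (\<chi> z w. pmf (Q (Transient z)) (Transient w))"

definition flux0 :: "('t::finite, 'd0::finite, 'd1) kernel \<Rightarrow> real ^ 't" where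
  "flux0 Q = (\<chi> z. \<Sum>y\<in>UNIV. pmf (Q (Transient z)) (Boundary0 y))"

definition flux1 :: "('t::finite, 'd0, 'd1::finite) kernel \<Rightarrow> real ^ 't" where
  "flux1 Q = (\<chi> z. \<Sum>y\<in>UNIV. pmf (Q (Transient z)) (Boundary1 y))"

(* Paths of length zero are allowed, so a single transient state is always irreducible. *)
definition irreducible_matrix :: "real ^ 't ^ 't \<Rightarrow> bool" where
  "irreducible_matrix A \<longleftrightarrow> (\<forall>z w. (z, w) \<in> {(x, y). A $ x $ y > 0}\<^sup>*)"

(* Since the boundary is absorbing, the probability of being transient at time n is the
   probability of not having been absorbed by time n. *)
definition absorption_certain :: "('t, 'd0, 'd1) kernel \<Rightarrow> bool" where
  "absorption_certain Q \<longleftrightarrow>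
     (\<forall>z. (\<lambda>n. measure_pmf.prob (nstep Q n (Transient z)) (range Transient)) \<longlonglongrightarrow> 0)"

definition absorbing_chain :: "('t::finite, 'd0::finite, 'd1::finite) kernel \<Rightarrow> bool" where
  "absorbing_chain Q \<longleftrightarrow>
     (\<forall>y. Q (Boundary0 y) = return_pmf (Boundary0 y)) \<and>
     (\<forall>y. Q (Boundary1 y) = return_pmf (Boundary1 y)) \<and>
     irreducible_matrix (restricted_matrix Q) \<and>
     absorption_certain Q"

(* Complex eigenvalues and eigenvectors are allowed. *)
definition complete_eigenvectors :: "real ^ 't ^ 't::finite \<Rightarrow> bool" where
  "complete_eigenvectors A \<longleftrightarrow>
     vec.span {v :: complex ^ 't. \<exists>l. map_matrix complex_of_real A *v v = l *s v} = UNIV"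

definition sk_reversible :: "('t \<Rightarrow> 't) \<Rightarrow> ('t \<Rightarrow> real) \<Rightarrow> real ^ 't ^ 't \<Rightarrow> bool" where
  "sk_reversible \<sigma> \<kappa> A \<longleftrightarrow>
     (\<forall>z. \<sigma> (\<sigma> z) = z) \<and> (\<forall>z. \<kappa> z > 0) \<and>
     (\<forall>z w. A $ z $ w = \<kappa> z / \<kappa> w * A $ \<sigma> z $ \<sigma> w)"

definition flux_compatible ::
    "('t::finite, 'd0::finite, 'd1::finite) kernel \<Rightarrow> ('t \<Rightarrow> 't) \<Rightarrow> ('t \<Rightarrow> real) \<Rightarrow> bool" where
  "flux_compatible Q \<sigma> \<kappa> \<longleftrightarrow> (\<forall>z. flux1 Q $ z = \<kappa> z * flux0 Q $ \<sigma> z)"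

(* A symmetrizing diagonal matrix is itself determined only up to a positive factor.  What
   fixes the scale of \<kappa> is flux compatibility, which singles out at most one of the
   weights c * \<kappa>; for the biased walk on {0..a} this is (p/q)^(a-z). *)
lemma flux_compatible_scale_unique:
  assumes "flux_compatible Q \<sigma> \<kappa>" "flux_compatible Q \<sigma> (\<lambda>z. c * \<kappa> z)"
    and "flux1 Q $ z \<noteq> 0"
  shows "c = 1"
proof -
  have "flux1 Q $ z = c * flux1 Q $ z"
    using assms(1,2) by (metis flux_compatible_def mult.assoc)
  with assms(3) show ?thesis by simp
qed

definition resolvent :: "('t::finite, 'd0, 'd1) kernel \<Rightarrow> real \<Rightarrow> real ^ 't ^ 't" where
  "resolvent Q \<gamma> = matrix_inv (mat 1 - (1 - \<gamma>) *\<^sub>R restricted_matrix Q)"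

definition pairing :: "'t pmf \<Rightarrow> real ^ 't::finite \<Rightarrow> real" where
  "pairing \<pi> v = (\<Sum>z\<in>UNIV. pmf \<pi> z * v $ z)"

definition coupling ::
    "('t::finite, 'd0::finite, 'd1::finite) kernel \<Rightarrow> 't pmf \<Rightarrow> real \<Rightarrow> real" where
  "coupling Q \<pi> \<gamma> =
     pairing \<pi> (resolvent Q \<gamma> *v flux0 Q) / pairing \<pi> (resolvent Q \<gamma> *v (flux0 Q + flux1 Q))"

definition reset_neutral ::
    "('t::finite, 'd0::finite, 'd1::finite) kernel \<Rightarrow> 't pmf \<Rightarrow> bool" where
  "reset_neutral Q \<pi> \<longleftrightarrow>
     (\<forall>\<gamma>\<in>{0<..<1}. \<forall>\<gamma>'\<in>{0<..<1}. coupling Q \<pi> \<gamma> = coupling Q \<pi> \<gamma>')"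

definition critical_value :: "('t::finite, 'd0::finite, 'd1::finite) kernel \<Rightarrow> real" where
  "critical_value Q =
     (THE c. \<exists>\<pi>. reset_neutral Q \<pi> \<and> (\<forall>\<gamma>\<in>{0<..<1}. coupling Q \<pi> \<gamma> = c))"

(* If \<sigma> z = z, the only such distribution is the point mass at z.  Division by zero gives 0,
   so the ratio condition also forces both masses to be positive. *)
definition balanced_pair :: "('t \<Rightarrow> 't) \<Rightarrow> ('t \<Rightarrow> real) \<Rightarrow> 't \<Rightarrow> 't pmf \<Rightarrow> bool" where
  "balanced_pair \<sigma> \<kappa> z \<pi> \<longleftrightarrow>
     set_pmf \<pi> \<subseteq> {z, \<sigma> z} \<and> pmf \<pi> z / pmf \<pi> (\<sigma> z) = sqrt (\<kappa> (\<sigma> z)) / sqrt (\<kappa> z)"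

end

theory Submission
  imports Defs
begin

text \<open>
  Put \<open>(S v) z = \<kappa> z * v (\<sigma> z)\<close>.  Reversibility says exactly that \<open>S\<close> commutes with the
  restricted transition matrix \<open>P\<close>, constancy of \<open>\<kappa> z * \<kappa> (\<sigma> z)\<close> says that \<open>S\<close> squares to
  the scalar \<open>K\<close>, and flux compatibility says that \<open>S\<close> maps the flux \<open>b0\<close> into the first
  boundary to the flux \<open>b1\<close> into the second.  Hence the resolvent \<open>R \<gamma>\<close> satisfies
  \<open>R \<gamma> b1 = S (R \<gamma> b0)\<close>, and with \<open>u = R \<gamma> b0\<close> the coupling is
  \<open>\<langle>\<pi>, u\<rangle> / (\<langle>\<pi>, u\<rangle> + \<langle>\<pi>, S u\<rangle>)\<close>.  A balanced pair \<open>\<pi>\<close> is a left eigenvector of \<open>S\<close> for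
  \<open>sqrt K\<close> (lemma \<open>balanced_pair_pairing_twist\<close>), so its coupling is \<open>1 / (1 + sqrt K)\<close>
  whatever \<open>\<gamma>\<close> is.

  It remains to see that no other constant value \<open>c\<close> can occur.  If the coupling of \<open>\<pi>\<close> is \<open>c\<close>
  for every \<open>\<gamma>\<close>, then the linear functional \<open>\<phi> v = (1 - c) * \<langle>\<pi>, v\<rangle> - c * \<langle>\<pi>, S v\<rangle>\<close> kills all
  the vectors \<open>R \<gamma> b0\<close>, hence their span \<open>W\<close>.  This span is invariant under \<open>P\<close> and
  contains \<open>b0\<close>, so by Brouwer's theorem, applied to the probability vectors in \<open>W\<close>, it
  contains a positive eigenvector \<open>r\<close> of \<open>P\<close> (lemma \<open>resolvent_orbit_eigenvector\<close>).  Being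
  positive, \<open>r\<close> lies in the \<open>sqrt K\<close>-eigenspace of \<open>S\<close> (lemma \<open>twist_positive_eigenvector\<close>),
  and \<open>\<phi> r = 0\<close> reads \<open>(1 - c - c * sqrt K) * \<langle>\<pi>, r\<rangle> = 0\<close> with \<open>\<langle>\<pi>, r\<rangle> > 0\<close>.
\<close>

section \<open>Positive eigenvectors of irreducible matrices\<close>

text \<open>
  At a zero of \<open>v\<close> the hypothesis \<open>step\<close> makes a sum of nonnegative terms nonpositive, so \<open>v\<close>
  also vanishes at all successors of that state.  Eigenvectors satisfy \<open>step\<close>, and so do
  supersolutions \<open>v \<ge> t *\<^sub>R (P *v v)\<close> with \<open>t > 0\<close>.
\<close>

lemma irreducible_zero_propagates:
  fixes P :: "real ^ 't::finite ^ 't"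
  assumes nonneg: "\<And>z w. P $ z $ w \<ge> 0"
    and irred: "irreducible_matrix P"
    and v: "\<And>z. v $ z \<ge> 0"
    and step: "\<And>z. v $ z = 0 \<Longrightarrow> (P *v v) $ z \<le> 0"
    and zero: "v $ z = 0"
  shows "v = 0"
proof -
  have "v $ w = 0" for w
  proof -
    have "(z, w) \<in> {(x, y). P $ x $ y > 0}\<^sup>*"
      using irred by (simp add: irreducible_matrix_def)
    then show ?thesis
    proof (induction rule: rtrancl_induct)
      case base
      show ?case by (fact zero)
    next
      case (step x y)
      have "P $ x $ y * v $ y \<le> (P *v v) $ x"
        unfolding matrix_vector_mult_def
        using member_le_sum[of y UNIV "\<lambda>y. P $ x $ y * v $ y"] nonneg v by simp
      then have "P $ x $ y * v $ y \<le> 0"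
        using assms(4)[OF step.IH] by linarith
      then show ?case
        using step.hyps(2) v[of y] by (smt (verit) case_prodD mem_Collect_eq mult_pos_pos)
    qed
  qed
  then show ?thesis by (simp add: vec_eq_iff)
qed

text \<open>
  A Perron-Frobenius theorem relative to an invariant subspace: the Brouwer fixed point is sought
  among the probability vectors in \<open>W\<close>.  The map normalizes \<open>v + P *v v\<close> rather than \<open>P *v v\<close>,
  because \<open>P *v v\<close> may vanish (a single state from which the chain is absorbed at once).
\<close>

lemma positive_eigenvector_in_invariant_subspace:
  fixes P :: "real ^ 't::finite ^ 't"
  assumes nonneg: "\<And>z w. P $ z $ w \<ge> 0"
    and irred: "irreducible_matrix P"
    and W: "subspace W"
    and inv: "\<And>v. v \<in> W \<Longrightarrow> P *v v \<in> W"
    and b: "b \<in> W" "\<And>z. b $ z \<ge> 0" "b \<noteq> 0"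
  obtains r l where "r \<in> W" "P *v r = l *\<^sub>R r" "\<And>z. r $ z > 0"
proof -
  define mass :: "real ^ 't \<Rightarrow> real" where "mass v = (\<Sum>z\<in>UNIV. v $ z)" for v
  have mass_add: "mass (u + v) = mass u + mass v" for u v
    by (simp add: mass_def sum.distrib)
  have mass_scale: "mass (c *\<^sub>R v) = c * mass v" for c v
    by (simp add: mass_def sum_distrib_left)
  have mass_nonneg: "mass v \<ge> 0" if "\<And>z. v $ z \<ge> 0" for v
    using that by (simp add: mass_def sum_nonneg)
  have Pv_nonneg: "(P *v v) $ z \<ge> 0" if "\<And>z. v $ z \<ge> 0" for v z
    using that nonneg by (simp add: matrix_vector_mult_def sum_nonneg)
  define D where "D = W \<inter> {v. (\<forall>z. 0 \<le> v $ z) \<and> mass v = 1}"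
  define f where "f v = (v + P *v v) /\<^sub>R mass (v + P *v v)" for v
  have cont_mass: "continuous_on A mass" for A
    unfolding mass_def by (intro continuous_intros)
  have Deq: "D = W \<inter> ((\<Inter>z. {v. 0 \<le> v $ z}) \<inter> {v. mass v = 1})"
    by (auto simp: D_def)
  have closed: "closed D"
    unfolding Deq
    by (intro closed_Int closed_subspace W closed_INT ballI closed_Collect_le closed_Collect_eq
        continuous_intros cont_mass)
  have bounded: "bounded D"
  proof (rule boundedI)
    fix v assume "v \<in> D"
    then have "\<And>z. 0 \<le> v $ z" "mass v = 1" by (auto simp: D_def)
    then show "norm v \<le> 1"
      using norm_le_l1_cart[of v] by (simp add: mass_def)
  qed
  have "compact D" using closed bounded by (simp add: compact_eq_bounded_closed)
  moreover have "convex D"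
    unfolding D_def
    by (rule convex_Int[OF subspace_imp_convex[OF W]])
      (auto simp: convex_def mass_add mass_scale)
  moreover have "D \<noteq> {}"
  proof -
    have "mass b \<noteq> 0"
      using b(2,3) by (auto simp: mass_def sum_nonneg_eq_0_iff vec_eq_iff)
    then have "b /\<^sub>R mass b \<in> D"
      using b mass_nonneg[of b] W by (auto simp: D_def mass_scale subspace_scale)
    then show ?thesis by blast
  qed
  moreover have mass_ge: "mass (v + P *v v) \<ge> 1" if "v \<in> D" for v
    using that mass_nonneg[of "P *v v"] Pv_nonneg[of v] by (auto simp: D_def mass_add)
  moreover have "continuous_on D f"
    unfolding f_def
    by (intro continuous_intros matrix_vector_mult_linear_continuous_on
        continuous_on_compose2[OF cont_mass[of UNIV]])
      (use mass_ge in fastforce)+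
  moreover have "f \<in> D \<rightarrow> D"
  proof
    fix v assume v: "v \<in> D"
    have "f v \<in> W"
      using v W inv by (auto simp: D_def f_def intro!: subspace_scale subspace_add)
    moreover have "0 \<le> f v $ z" for z
      using v Pv_nonneg[of v z] mass_ge[OF v] by (auto simp: f_def D_def)
    moreover have "mass (f v) = 1"
      using mass_ge[OF v] by (simp add: f_def mass_scale)
    ultimately show "f v \<in> D" by (simp add: D_def)
  qed
  ultimately obtain r where r: "r \<in> D" "f r = r"
    using brouwer by metis
  define m where "m = mass (r + P *v r)"
  have "m \<ge> 1" using mass_ge[OF r(1)] by (simp add: m_def)
  have "r + P *v r = m *\<^sub>R f r"
    using \<open>m \<ge> 1\<close> by (simp add: f_def m_def)
  then have eig: "P *v r = (m - 1) *\<^sub>R r"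
    using r(2) by (simp add: algebra_simps)
  have "r \<noteq> 0" using r(1) by (auto simp: D_def mass_def)
  have rn: "r $ z \<ge> 0" for z using r(1) by (simp add: D_def)
  have "r $ z \<noteq> 0" for z
    using irreducible_zero_propagates[OF nonneg irred rn, of z] \<open>r \<noteq> 0\<close> eig by auto
  then have "r $ z > 0" for z using rn[of z] by (simp add: less_le)
  then show thesis using that[of r "m - 1"] r(1) eig by (auto simp: D_def)
qed

section \<open>The reversibility symmetry\<close>

definition twist :: "('t \<Rightarrow> 't) \<Rightarrow> ('t \<Rightarrow> real) \<Rightarrow> real ^ 't \<Rightarrow> real ^ 't" where
  "twist \<sigma> \<kappa> v = (\<chi> z. \<kappa> z * v $ \<sigma> z)"

lemma twist_commute:
  fixes P :: "real ^ 't::finite ^ 't"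
  assumes "sk_reversible \<sigma> \<kappa> P"
  shows "P *v twist \<sigma> \<kappa> v = twist \<sigma> \<kappa> (P *v v)"
proof -
  have inv: "\<sigma> (\<sigma> z) = z" and pos: "\<kappa> z > 0"
    and rev: "P $ z $ w = \<kappa> z / \<kappa> w * P $ \<sigma> z $ \<sigma> w" for z w
    using assms unfolding sk_reversible_def by blast+
  have bij: "bij \<sigma>" using inv by (metis involuntory_imp_bij)
  have "(\<Sum>w\<in>UNIV. P $ z $ w * (\<kappa> w * v $ \<sigma> w)) = \<kappa> z * (\<Sum>w\<in>UNIV. P $ \<sigma> z $ w * v $ w)" for z
  proof -
    have "P $ z $ w * (\<kappa> w * v $ \<sigma> w) = \<kappa> z * (P $ \<sigma> z $ \<sigma> w * v $ \<sigma> w)" for w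
      using pos[of w] by (subst rev[of z w]) (simp add: field_simps)
    then have "(\<Sum>w\<in>UNIV. P $ z $ w * (\<kappa> w * v $ \<sigma> w))
        = \<kappa> z * (\<Sum>w\<in>UNIV. P $ \<sigma> z $ \<sigma> w * v $ \<sigma> w)"
      by (simp only: sum_distrib_left)
    also have "(\<Sum>w\<in>UNIV. P $ \<sigma> z $ \<sigma> w * v $ \<sigma> w) = (\<Sum>w\<in>UNIV. P $ \<sigma> z $ w * v $ w)"
      by (rule sum.reindex_bij_betw[OF bij, of "\<lambda>w. P $ \<sigma> z $ w * v $ w"])
    finally show ?thesis .
  qed
  then show ?thesis
    by (simp add: vec_eq_iff twist_def matrix_vector_mult_def)
qed

text \<open>
  The positive eigenvector is unique up to a factor: with \<open>M\<close> the largest ratio of \<open>S r\<close> to \<open>r\<close>,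
  the vector \<open>M *\<^sub>R r - S r\<close> is a nonnegative eigenvector with a zero, hence zero.  As \<open>S\<close>
  squares to \<open>K\<close>, the factor is \<open>M = sqrt K\<close>.
\<close>

lemma twist_positive_eigenvector:
  fixes P :: "real ^ 't::finite ^ 't"
  assumes nonneg: "\<And>z w. P $ z $ w \<ge> 0"
    and irred: "irreducible_matrix P"
    and rev: "sk_reversible \<sigma> \<kappa> P"
    and K: "\<And>z. \<kappa> z * \<kappa> (\<sigma> z) = K"
    and eig: "P *v r = l *\<^sub>R r"
    and pos: "\<And>z. r $ z > 0"
  shows "twist \<sigma> \<kappa> r = sqrt K *\<^sub>R r"
proof -
  have inv: "\<sigma> (\<sigma> z) = z" and kpos: "\<kappa> z > 0" for z
    using rev unfolding sk_reversible_def by blast+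
  define M where "M = Max (range (\<lambda>z. twist \<sigma> \<kappa> r $ z / r $ z))"
  define u where "u = M *\<^sub>R r - twist \<sigma> \<kappa> r"
  have "M \<in> range (\<lambda>z. twist \<sigma> \<kappa> r $ z / r $ z)"
    unfolding M_def by (rule Max_in) auto
  then obtain z where z: "M = twist \<sigma> \<kappa> r $ z / r $ z" by blast
  have "twist \<sigma> \<kappa> r $ w / r $ w \<le> M" for w
    unfolding M_def by (rule Max_ge) auto
  then have un: "u $ w \<ge> 0" for w
    using pos[of w] by (simp add: u_def divide_le_eq)
  have uz: "u $ z = 0" using z pos[of z] by (simp add: u_def)
  have "P *v u = l *\<^sub>R u"
    by (simp add: u_def matrix_vector_mult_diff_distrib matrix_vector_mult_scaleR
        twist_commute[OF rev] eig)
      (simp add: twist_def vec_eq_iff algebra_simps)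
  then have "u = 0"
    using irreducible_zero_propagates[OF nonneg irred un _ uz] by simp
  then have tw: "twist \<sigma> \<kappa> r = M *\<^sub>R r" by (simp add: u_def)
  have comp: "\<kappa> w * r $ \<sigma> w = M * r $ w" for w
    using arg_cong[OF tw, of "\<lambda>v. v $ w"] by (simp add: twist_def)
  have "K * r $ z = \<kappa> z * (\<kappa> (\<sigma> z) * r $ \<sigma> (\<sigma> z))"
    using K[of z] by (simp add: inv mult.assoc[symmetric])
  also have "\<dots> = M * (\<kappa> z * r $ \<sigma> z)" by (simp only: comp mult.left_commute)
  also have "\<dots> = M\<^sup>2 * r $ z" by (simp add: comp power2_eq_square)
  finally have "K = M\<^sup>2" using pos[of z] by simp
  moreover have "M \<ge> 0" using z pos kpos by (simp add: twist_def less_imp_le)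
  ultimately show ?thesis using tw by simp
qed

section \<open>The resolvent of a substochastic matrix\<close>

definition substochastic :: "real ^ 't ^ 't::finite \<Rightarrow> bool" where
  "substochastic P \<longleftrightarrow> (\<forall>z w. P $ z $ w \<ge> 0) \<and> (\<forall>z. (\<Sum>w\<in>UNIV. P $ z $ w) \<le> 1)"

text \<open>
  Minimum principle: at a state where \<open>u\<close> is smallest and negative, averaging by \<open>t *\<^sub>R P\<close> cannot
  go below \<open>t\<close> times that minimum.  The case \<open>m = 0\<close> gives positivity of the resolvent and
  injectivity of \<open>mat 1 - t *\<^sub>R P\<close>, a negative \<open>m\<close> gives bounds uniform in \<open>t\<close>.
\<close>

lemma resolvent_lower_bound:
  fixes P :: "real ^ 't ^ 't::finite"
  assumes P: "substochastic P" and t: "0 < t" "t < 1"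
    and eq: "u = f + t *\<^sub>R (P *v u)" and m: "m \<le> 0" "\<And>z. (1 - t) * m \<le> f $ z"
  shows "m \<le> u $ z"
proof -
  define k where "k = Min (range (($) u))"
  have "k \<in> range (($) u)" unfolding k_def by (rule Min_in) auto
  then obtain x where x: "k = u $ x" by blast
  have le: "k \<le> u $ w" for w unfolding k_def by (rule Min_le) auto
  have "m \<le> k"
  proof (rule ccontr)
    assume "\<not> m \<le> k"
    then have "k < m" by simp
    with m(1) have "k < 0" by simp
    have "(\<Sum>w\<in>UNIV. P $ x $ w) \<le> 1" using P by (simp add: substochastic_def)
    then have "k \<le> (\<Sum>w\<in>UNIV. P $ x $ w) * k"
      using \<open>k < 0\<close> by (simp add: mult_le_cancel_right)
    also have "\<dots> \<le> (\<Sum>w\<in>UNIV. P $ x $ w * u $ w)"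
      unfolding sum_distrib_right
      using P le by (intro sum_mono mult_left_mono) (auto simp: substochastic_def)
    finally have "t * k \<le> t * (P *v u) $ x"
      using t by (simp add: matrix_vector_mult_def)
    moreover have "u $ x = f $ x + t * (P *v u) $ x"
      using arg_cong[OF eq, of "\<lambda>v. v $ x"] by simp
    ultimately have "(1 - t) * m \<le> (1 - t) * k"
      using m(2)[of x] x by (simp add: algebra_simps)
    then show False using t \<open>k < m\<close> by simp
  qed
  then show ?thesis using le[of z] by simp
qed

lemma resolvent_solves:
  fixes P :: "real ^ 't ^ 't::finite"
  assumes P: "substochastic P" and t: "0 < t" "t < 1"
  defines "R \<equiv> matrix_inv (mat 1 - t *\<^sub>R P)"
  shows "R *v f = f + t *\<^sub>R (P *v (R *v f))"
    and "u = f + t *\<^sub>R (P *v u) \<Longrightarrow> u = R *v f"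
proof -
  define A where "A = mat 1 - t *\<^sub>R P"
  have A: "A *v v = v - t *\<^sub>R (P *v v)" for v
    by (simp add: A_def matrix_vector_mult_diff_rdistrib scaleR_matrix_vector_assoc)
  have "u = 0" if "A *v u = 0" for u
  proof -
    have "u = 0 + t *\<^sub>R (P *v u)" using that by (simp add: A)
    from resolvent_lower_bound[OF P t this, of 0] have "u $ z \<ge> 0" for z by simp
    moreover have "- u = 0 + t *\<^sub>R (P *v (- u))"
      using that by (simp add: A linear_neg[OF matrix_vector_mul_linear])
    from resolvent_lower_bound[OF P t this, of 0] have "(- u) $ z \<ge> 0" for z by simp
    ultimately show ?thesis by (auto simp: vec_eq_iff intro: antisym)
  qed
  then have "\<exists>B. B ** A = mat 1" by (simp add: matrix_left_invertible_ker)
  then have "invertible A" by (simp add: invertible_left_inverse)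
  then have "A ** R = mat 1 \<and> R ** A = mat 1"
    unfolding R_def A_def[symmetric] invertible_def matrix_inv_def by (rule someI_ex)
  then have 1: "A ** R = mat 1" and 2: "R ** A = mat 1" by auto
  have "A *v (R *v f) = f" using 1 by (simp add: matrix_vector_mul_assoc)
  then show "R *v f = f + t *\<^sub>R (P *v (R *v f))" by (simp add: A algebra_simps)
  assume "u = f + t *\<^sub>R (P *v u)"
  then have "A *v u = f" by (simp add: A algebra_simps)
  then show "u = R *v f" using 2 by (metis matrix_vector_mul_assoc matrix_vector_mul_lid)
qed

lemma resolvent_tendsto:
  fixes P :: "real ^ 't ^ 't::finite"
  assumes P: "substochastic P" and f: "\<And>z. f $ z \<ge> 0" "\<And>z. f $ z \<le> 1"
  shows "((\<lambda>t. matrix_inv (mat 1 - t *\<^sub>R P) *v f) \<longlongrightarrow> f) (at_right 0)"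
proof -
  define U where "U t = matrix_inv (mat 1 - t *\<^sub>R P) *v f" for t
  have ev: "\<forall>\<^sub>F t::real in at_right 0. 0 < t \<and> t < 1/2"
    unfolding eventually_at_right_field by (intro exI[of _ "1/2"]) auto
  have bound: "\<bar>U t $ z\<bar> \<le> 2" if t: "0 < t" "t < 1/2" for t z
  proof -
    have t1: "t < 1" using t by simp
    have eq: "U t = f + t *\<^sub>R (P *v U t)"
      unfolding U_def by (rule resolvent_solves(1)[OF P t(1) t1])
    have "0 \<le> U t $ z" using resolvent_lower_bound[OF P t(1) t1 eq, of 0] f by simp
    moreover have "- U t = - f + t *\<^sub>R (P *v (- U t))"
      unfolding linear_neg[OF matrix_vector_mul_linear]
      using arg_cong[OF eq, of uminus] by simp
    then have "-2 \<le> (- U t) $ z"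
    proof (rule resolvent_lower_bound[OF P t(1) t1])
      show "(1 - t) * (-2) \<le> (- f) $ w" for w using f(2)[of w] t by simp
    qed simp
    ultimately show ?thesis by simp
  qed
  have "((\<lambda>t. t *\<^sub>R (P *v U t)) \<longlongrightarrow> 0) (at_right 0)"
  proof (rule vec_tendstoI)
    fix z
    have "((\<lambda>t. t * (P *v U t) $ z) \<longlongrightarrow> 0) (at_right 0)"
    proof (rule tendsto_0_le[where f = "\<lambda>t. t" and K = 2])
      show "((\<lambda>t. t) \<longlongrightarrow> (0::real)) (at_right 0)" by (rule tendsto_ident_at)
      show "\<forall>\<^sub>F t in at_right 0. norm (t * (P *v U t) $ z) \<le> norm t * 2"
        using ev
      proof eventually_elim
        case (elim t)
        have "\<bar>(P *v U t) $ z\<bar> \<le> (\<Sum>w\<in>UNIV. \<bar>P $ z $ w * U t $ w\<bar>)"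
          by (simp add: matrix_vector_mult_def sum_abs)
        also have "\<dots> \<le> (\<Sum>w\<in>UNIV. P $ z $ w * 2)"
          using P bound[of t] elim
          by (intro sum_mono) (auto simp: abs_mult substochastic_def intro!: mult_left_mono)
        also have "\<dots> \<le> 2"
          using P by (simp add: substochastic_def flip: sum_distrib_right)
        finally show ?case by (simp add: abs_mult mult_left_mono)
      qed
    qed
    then show "((\<lambda>t. (t *\<^sub>R (P *v U t)) $ z) \<longlongrightarrow> 0 $ z) (at_right 0)" by simp
  qed
  then have "((\<lambda>t. f + t *\<^sub>R (P *v U t)) \<longlongrightarrow> f + 0) (at_right 0)"
    by (intro tendsto_intros)
  moreover have "\<forall>\<^sub>F t in at_right 0. f + t *\<^sub>R (P *v U t) = U t"
    using ev
  proof eventually_elim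
    case (elim t)
    then show ?case unfolding U_def using resolvent_solves(1)[OF P, of t f] by simp
  qed
  ultimately have "(U \<longlongrightarrow> f) (at_right 0)" by (simp add: tendsto_cong)
  then show ?thesis by (simp add: U_def[abs_def])
qed

text \<open>
  Write \<open>U t\<close> for the resolvent applied to \<open>f\<close>.  The span \<open>W\<close> of all \<open>U t\<close> is closed, so it
  contains the limit \<open>f\<close> of \<open>U t\<close> for \<open>t\<close> tending to 0; the resolvent equation
  \<open>t *\<^sub>R (P *v U t) = U t - f\<close> then shows that \<open>W\<close> is invariant under \<open>P\<close>.
\<close>

lemma resolvent_orbit_eigenvector:
  fixes P :: "real ^ 't ^ 't::finite"
  assumes P: "substochastic P" and irred: "irreducible_matrix P"
    and f: "\<And>z. f $ z \<ge> 0" "\<And>z. f $ z \<le> 1" "f \<noteq> 0"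
    and phi: "linear \<phi>"
    and zero: "\<And>t. 0 < t \<Longrightarrow> t < 1 \<Longrightarrow> \<phi> (matrix_inv (mat 1 - t *\<^sub>R P) *v f) = 0"
  obtains r l where "\<phi> r = 0" "P *v r = l *\<^sub>R r" "\<And>z. r $ z > 0"
proof -
  define U where "U t = matrix_inv (mat 1 - t *\<^sub>R P) *v f" for t
  define W where "W = span (U ` {0<..<1})"
  have W: "subspace W" by (simp add: W_def)
  have U: "U t \<in> W" if "0 < t" "t < 1" for t
    using that by (auto simp: W_def intro: span_base)
  have fW: "f \<in> W"
  proof (rule Lim_in_closed_set)
    show "closed W" by (rule closed_subspace[OF W])
    have "\<forall>\<^sub>F t::real in at_right 0. 0 < t \<and> t < 1"
      unfolding eventually_at_right_field by (intro exI[of _ "1"]) auto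
    then show "\<forall>\<^sub>F t in at_right 0. U t \<in> W"
      by eventually_elim (simp add: U)
    show "(U \<longlongrightarrow> f) (at_right 0)"
      unfolding U_def[abs_def] by (rule resolvent_tendsto[OF P f(1,2)])
  qed (simp add: trivial_limit_at_right_real)
  have inv: "P *v v \<in> W" if "v \<in> W" for v
    using that unfolding W_def
  proof (induction rule: span_induct_alt)
    case base
    show ?case by (simp add: span_zero)
  next
    case (step c u v)
    then obtain t where t: "0 < t" "t < 1" "u = U t" by auto
    have "t *\<^sub>R (P *v u) = U t - f"
      unfolding t(3) U_def using resolvent_solves(1)[OF P t(1,2), of f] by (simp add: algebra_simps)
    then have "P *v u = (U t - f) /\<^sub>R t"
      using t(1) by (metis divideR_right less_irrefl)
    then have "P *v u \<in> W" using U[OF t(1,2)] fW W by (simp add: subspace_scale subspace_diff)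
    then show ?case
      using step.IH W by (simp add: matrix_vector_right_distrib matrix_vector_mult_scaleR
          W_def[symmetric] subspace_add subspace_scale)
  qed
  obtain r l where r: "r \<in> W" "P *v r = l *\<^sub>R r" "\<And>z. r $ z > 0"
    using positive_eigenvector_in_invariant_subspace[OF _ irred W inv fW f(1,3)] P
    unfolding substochastic_def by blast
  have "\<phi> v = 0" if "v \<in> W" for v
  proof (rule linear_eq_0_on_span[OF phi])
    show "v \<in> span (U ` {0<..<1})" using that by (simp add: W_def)
    show "\<phi> x = 0" if "x \<in> U ` {0<..<1}" for x using that zero by (auto simp: U_def)
  qed
  then show thesis using that r by blast
qed

section \<open>Absorbing chains\<close>

lemma chain_row_sum:
  fixes Q :: "('t::finite, 'd0::finite, 'd1::finite) kernel"
  shows "(\<Sum>w\<in>UNIV. restricted_matrix Q $ z $ w) + flux0 Q $ z + flux1 Q $ z = 1"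
proof -
  have U: "(UNIV :: ('t, 'd0, 'd1) state set)
      = range Transient \<union> range Boundary0 \<union> range Boundary1"
  proof (intro equalityI subsetI)
    fix x :: "('t, 'd0, 'd1) state"
    show "x \<in> range Transient \<union> range Boundary0 \<union> range Boundary1" by (cases x) blast+
  qed simp
  then have fin: "finite (UNIV :: ('t, 'd0, 'd1) state set)" by (metis finite finite_Un finite_imageI)
  have "1 = (\<Sum>x\<in>UNIV. pmf (Q (Transient z)) x)"
    by (rule sum_pmf_eq_1[symmetric]) (use fin in simp_all)
  also have "\<dots> = (\<Sum>w\<in>UNIV. pmf (Q (Transient z)) (Transient w))
      + (\<Sum>y\<in>UNIV. pmf (Q (Transient z)) (Boundary0 y))
      + (\<Sum>y\<in>UNIV. pmf (Q (Transient z)) (Boundary1 y))"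
    unfolding U
    by (subst sum.union_disjoint; (force simp: sum.reindex inj_on_def)?)+
  finally show ?thesis
    by (simp add: restricted_matrix_def flux0_def flux1_def)
qed

lemma chain_nonneg:
  fixes Q :: "('t::finite, 'd0::finite, 'd1::finite) kernel"
  shows "restricted_matrix Q $ z $ w \<ge> 0" "flux0 Q $ z \<ge> 0" "flux1 Q $ z \<ge> 0"
  by (simp_all add: restricted_matrix_def flux0_def flux1_def sum_nonneg)

lemma chain_substochastic:
  fixes Q :: "('t::finite, 'd0::finite, 'd1::finite) kernel"
  shows "substochastic (restricted_matrix Q)"
  unfolding substochastic_def
  using chain_row_sum[of Q] chain_nonneg[of Q] by (smt (verit))

text \<open>
  Without any flux the chain never leaves the transient states, contradicting certain absorption.
\<close>

lemma chain_flux_nonzero: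
  fixes Q :: "('t::finite, 'd0::finite, 'd1::finite) kernel"
  assumes "absorption_certain Q"
  shows "flux0 Q + flux1 Q \<noteq> 0"
proof
  assume "flux0 Q + flux1 Q = 0"
  then have *: "flux0 Q $ z + flux1 Q $ z = 0" for z
    by (metis vector_add_component zero_index)
  then have 0: "flux0 Q $ z = 0" "flux1 Q $ z = 0" for z
    using chain_nonneg(2,3)[of Q z] *[of z] by linarith+
  have step: "set_pmf (Q (Transient z)) \<subseteq> range Transient" for z
  proof
    fix x assume "x \<in> set_pmf (Q (Transient z))"
    moreover have "pmf (Q (Transient z)) (Boundary0 y) = 0" for y
      using 0(1)[of z] by (simp add: flux0_def sum_nonneg_eq_0_iff)
    moreover have "pmf (Q (Transient z)) (Boundary1 y) = 0" for y
      using 0(2)[of z] by (simp add: flux1_def sum_nonneg_eq_0_iff)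
    ultimately show "x \<in> range Transient"
      by (cases x) (auto simp: set_pmf_iff)
  qed
  have "set_pmf (nstep Q n (Transient z)) \<subseteq> range Transient" for n z
  proof (induction n)
    case (Suc n)
    show ?case
    proof
      fix x assume "x \<in> set_pmf (nstep Q (Suc n) (Transient z))"
      then obtain y where y: "y \<in> set_pmf (nstep Q n (Transient z))" "x \<in> set_pmf (Q y)"
        by auto
      then obtain w where "y = Transient w" using Suc.IH by blast
      then show "x \<in> range Transient" using y(2) step by blast
    qed
  qed simp
  then have "measure_pmf.prob (nstep Q n (Transient z)) (range Transient) = 1" for n z
    by (subst measure_pmf.prob_eq_1) (auto simp: AE_measure_pmf_iff)
  then have "(\<lambda>n::nat. 1::real) \<longlonglongrightarrow> 0"
    using assms by (simp add: absorption_certain_def)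
  then show False by (simp add: LIMSEQ_const_iff)
qed

lemma linear_pairing: "linear (pairing \<pi>)"
  unfolding pairing_def
  by (intro linearI) (simp_all add: sum.distrib sum_distrib_left algebra_simps)

lemma pairing_pos:
  assumes "\<And>z. v $ z > 0"
  shows "pairing \<pi> v > 0"
proof -
  obtain z where "z \<in> set_pmf \<pi>" using set_pmf_not_empty[of \<pi>] by blast
  then have "pmf \<pi> z * v $ z > 0" using assms by (simp add: pmf_positive)
  also have "\<dots> \<le> pairing \<pi> v"
    unfolding pairing_def
    by (rule member_le_sum) (use assms in \<open>auto simp: less_imp_le\<close>)
  finally show ?thesis .
qed

lemma balanced_pair_exists:
  assumes "\<And>z. \<kappa> z > (0::real)"
  shows "\<exists>\<pi>. balanced_pair \<sigma> \<kappa> z \<pi>"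
proof (cases "\<sigma> z = z")
  case True
  then have "balanced_pair \<sigma> \<kappa> z (return_pmf z)"
    using assms[of z] by (simp add: balanced_pair_def)
  then show ?thesis ..
next
  case False
  define a b where "a = sqrt (\<kappa> (\<sigma> z))" and "b = sqrt (\<kappa> z)"
  have ab: "a > 0" "b > 0" using assms by (simp_all add: a_def b_def)
  define p where "p = a / (a + b)"
  have p: "0 \<le> p" "p \<le> 1" "1 - p = b / (a + b)"
    using ab by (auto simp: p_def field_simps)
  define \<pi> where "\<pi> = map_pmf (\<lambda>x. if x then z else \<sigma> z) (bernoulli_pmf p)"
  have "pmf \<pi> z = p"
  proof -
    have "(\<lambda>x. if x then z else \<sigma> z) -` {z} = {True}" using False by (auto split: if_splits)
    then show ?thesis using p by (simp add: \<pi>_def pmf_map measure_pmf_single)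
  qed
  moreover have "pmf \<pi> (\<sigma> z) = 1 - p"
  proof -
    have "(\<lambda>x. if x then z else \<sigma> z) -` {\<sigma> z} = {False}" using False by (auto split: if_splits)
    then show ?thesis using p by (simp add: \<pi>_def pmf_map measure_pmf_single)
  qed
  moreover have "p / (1 - p) = a / b" using ab by (simp add: p(3)) (simp add: p_def)
  moreover have "set_pmf \<pi> \<subseteq> {z, \<sigma> z}" by (auto simp: \<pi>_def)
  ultimately have "balanced_pair \<sigma> \<kappa> z \<pi>" by (simp add: balanced_pair_def a_def b_def)
  then show ?thesis ..
qed

text \<open>
  On \<open>{z, \<sigma> z}\<close> the balance condition makes \<open>\<pi>\<close> proportional to \<open>1 / sqrt \<kappa>\<close>, and \<open>S\<close> exchanges
  the two states, multiplying the mass at one by the ratio that turns it into \<open>sqrt K\<close> times the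
  mass at the other.
\<close>

lemma balanced_pair_pairing_twist:
  assumes inv: "\<sigma> (\<sigma> z) = z" and pos: "\<And>z. \<kappa> z > 0"
    and K: "\<kappa> z * \<kappa> (\<sigma> z) = K"
    and bal: "balanced_pair \<sigma> \<kappa> z \<pi>"
  shows "pairing \<pi> (twist \<sigma> \<kappa> v) = sqrt K * pairing \<pi> v"
proof -
  define a b where "a = sqrt (\<kappa> (\<sigma> z))" and "b = sqrt (\<kappa> z)"
  have ab: "a > 0" "b > 0" using pos by (simp_all add: a_def b_def)
  have sq: "\<kappa> (\<sigma> z) = a * a" "\<kappa> z = b * b" using pos by (simp_all add: a_def b_def less_imp_le)
  have s: "sqrt K = a * b" by (simp add: a_def b_def mult.commute flip: K real_sqrt_mult)
  have supp: "pmf \<pi> w = 0" if "w \<notin> {z, \<sigma> z}" for w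
    using bal that by (auto simp: balanced_pair_def set_pmf_iff)
  have pair: "pairing \<pi> u = (\<Sum>w\<in>{z, \<sigma> z}. pmf \<pi> w * u $ w)" for u
    unfolding pairing_def by (rule sum.mono_neutral_right) (use supp in auto)
  have ratio: "pmf \<pi> z / pmf \<pi> (\<sigma> z) = a / b"
    using bal by (simp add: balanced_pair_def a_def b_def)
  show ?thesis
  proof (cases "\<sigma> z = z")
    case True
    then have "a = b" by (simp add: a_def b_def)
    then show ?thesis using True by (simp add: pair twist_def s sq(2))
  next
    case False
    have "pmf \<pi> (\<sigma> z) \<noteq> 0" using ratio ab by auto
    then have r: "b * pmf \<pi> z = a * pmf \<pi> (\<sigma> z)"
      using ratio ab by (simp add: field_simps)
    have "pairing \<pi> (twist \<sigma> \<kappa> v)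
        = b * (b * pmf \<pi> z) * v $ \<sigma> z + a * (a * pmf \<pi> (\<sigma> z)) * v $ z"
      using False by (simp add: pair twist_def inv sq)
    also have "\<dots> = b * (a * pmf \<pi> (\<sigma> z)) * v $ \<sigma> z + a * (b * pmf \<pi> z) * v $ z"
      by (simp only: r)
    also have "\<dots> = sqrt K * pairing \<pi> v"
      using False by (simp add: pair s algebra_simps)
    finally show ?thesis .
  qed
qed

section \<open>The critical value\<close>

theorem mainTheorem9:
  fixes Q :: "('t::finite, 'd0::finite, 'd1::finite) kernel"
    and \<sigma> :: "'t \<Rightarrow> 't" and \<kappa> :: "'t \<Rightarrow> real" and K :: real
  assumes "absorbing_chain Q"
    and "complete_eigenvectors (restricted_matrix Q)"
    and "sk_reversible \<sigma> \<kappa> (restricted_matrix Q)"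
    and "\<forall>z. \<kappa> z * \<kappa> (\<sigma> z) = K"
    and "flux_compatible Q \<sigma> \<kappa>"
  shows "critical_value Q = 1 / (1 + sqrt K) \<and>
         (\<forall>\<pi>. reset_neutral Q \<pi> \<longrightarrow>
            (\<forall>\<gamma>\<in>{0<..<1}. coupling Q \<pi> \<gamma> = 1 / (1 + sqrt K))) \<and>
         (\<forall>z. (\<exists>\<pi>. balanced_pair \<sigma> \<kappa> z \<pi>) \<and>
              (\<forall>\<pi>. balanced_pair \<sigma> \<kappa> z \<pi> \<longrightarrow> reset_neutral Q \<pi>))"
proof -
  define P where "P = restricted_matrix Q"
  define U where "U \<gamma> = resolvent Q \<gamma> *v flux0 Q" for \<gamma>
  let ?S = "twist \<sigma> \<kappa>"
  have irred: "irreducible_matrix P" and abs: "absorption_certain Q"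
    using assms(1) by (auto simp: absorbing_chain_def P_def)
  have rev: "sk_reversible \<sigma> \<kappa> P" using assms(3) by (simp add: P_def)
  have inv: "\<sigma> (\<sigma> z) = z" and pos: "\<kappa> z > 0" for z
    using assms(3) unfolding sk_reversible_def by blast+
  have K: "\<kappa> z * \<kappa> (\<sigma> z) = K" for z using assms(4) by blast
  have Kpos: "K > 0" using K[of undefined] pos by (metis mult_pos_pos)
  have sub: "substochastic P" unfolding P_def by (rule chain_substochastic)
  have Pn: "P $ z $ w \<ge> 0" for z w unfolding P_def by (rule chain_nonneg)
  have flux1: "flux1 Q = ?S (flux0 Q)"
    using assms(5) by (simp add: flux_compatible_def twist_def vec_eq_iff)
  have R: "resolvent Q \<gamma> = matrix_inv (mat 1 - (1 - \<gamma>) *\<^sub>R P)" for \<gamma>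
    by (simp add: resolvent_def P_def)
  have lin_S: "?S (u + v) = ?S u + ?S v" "?S (c *\<^sub>R u) = c *\<^sub>R ?S u" for u v c
    by (simp_all add: twist_def vec_eq_iff algebra_simps)
  have U_eq: "U \<gamma> = flux0 Q + (1 - \<gamma>) *\<^sub>R (P *v U \<gamma>)" if "\<gamma> \<in> {0<..<1}" for \<gamma>
    unfolding U_def R by (rule resolvent_solves(1)[OF sub]) (use that in auto)
  have U1: "resolvent Q \<gamma> *v flux1 Q = ?S (U \<gamma>)" if "\<gamma> \<in> {0<..<1}" for \<gamma>
  proof -
    have "?S (U \<gamma>) = flux1 Q + (1 - \<gamma>) *\<^sub>R (P *v ?S (U \<gamma>))"
      by (subst U_eq[OF that]) (simp only: lin_S flux1 twist_commute[OF rev])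
    then show ?thesis
      unfolding R using resolvent_solves(2)[OF sub, of "1 - \<gamma>"] that by simp
  qed
  have coup: "coupling Q \<pi> \<gamma>
      = pairing \<pi> (U \<gamma>) / (pairing \<pi> (U \<gamma>) + pairing \<pi> (?S (U \<gamma>)))"
    if "\<gamma> \<in> {0<..<1}" for \<pi> \<gamma>
    by (simp add: coupling_def matrix_vector_right_distrib U1[OF that] U_def[symmetric]
        linear_add[OF linear_pairing])
  have total_pos: "pairing \<pi> (U \<gamma>) + pairing \<pi> (?S (U \<gamma>)) > 0"
    if g: "\<gamma> \<in> {0<..<1}" for \<pi> \<gamma>
  proof -
    define u where "u = resolvent Q \<gamma> *v (flux0 Q + flux1 Q)"
    have t: "0 < 1 - \<gamma>" "1 - \<gamma> < 1" using g by auto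
    have eq: "u = (flux0 Q + flux1 Q) + (1 - \<gamma>) *\<^sub>R (P *v u)"
      unfolding u_def R by (rule resolvent_solves(1)[OF sub t])
    have comp: "u $ z = flux0 Q $ z + flux1 Q $ z + (1 - \<gamma>) * (P *v u) $ z" for z
      using arg_cong[OF eq, of "\<lambda>v. v $ z"] by simp
    have un: "u $ z \<ge> 0" for z
      using resolvent_lower_bound[OF sub t eq, of 0] chain_nonneg[of Q] by simp
    have "u $ z \<noteq> 0" for z
    proof
      assume z: "u $ z = 0"
      have "(P *v u) $ x \<le> 0" if "u $ x = 0" for x
        using comp[of x] that chain_nonneg(2,3)[of Q x] t(1)
        by (smt (verit) mult_pos_pos)
      then have "u = 0" by (rule irreducible_zero_propagates[OF Pn irred un _ z])
      then show False using eq chain_flux_nonzero[OF abs] by simp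
    qed
    then have "pairing \<pi> u > 0" using un by (intro pairing_pos) (simp add: less_le)
    then show ?thesis
      by (simp add: u_def matrix_vector_right_distrib U1[OF g] U_def[symmetric]
          linear_add[OF linear_pairing])
  qed
  have flux0_nz: "flux0 Q \<noteq> 0"
  proof
    assume "flux0 Q = 0"
    then have "flux0 Q + flux1 Q = 0" by (simp add: flux1) (simp add: twist_def vec_eq_iff)
    then show False using chain_flux_nonzero[OF abs] by blast
  qed
  have neutral_val: "coupling Q \<pi> \<gamma> = 1 / (1 + sqrt K)"
    if neutral: "reset_neutral Q \<pi>" and g: "\<gamma> \<in> {0<..<1}" for \<pi> \<gamma>
  proof -
    define c where "c = coupling Q \<pi> \<gamma>"
    \<comment> \<open>The vanishing of \<open>\<phi>\<close> at \<open>U \<gamma>\<close> is the equation \<open>coupling Q \<pi> \<gamma> = c\<close>, cleared of its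
      denominator.\<close>
    define \<phi> where "\<phi> v = (1 - c) * pairing \<pi> v - c * pairing \<pi> (?S v)" for v
    have "linear \<phi>"
      unfolding \<phi>_def
      by (intro linearI)
        (simp_all add: lin_S linear_add[OF linear_pairing] linear_scale[OF linear_pairing] algebra_simps)
    moreover have "\<phi> (matrix_inv (mat 1 - t *\<^sub>R P) *v flux0 Q) = 0" if t: "0 < t" "t < 1" for t
    proof -
      have d: "1 - t \<in> {0<..<1}" using t by simp
      have "c = coupling Q \<pi> (1 - t)"
        using neutral g d unfolding reset_neutral_def c_def by blast
      then have "c * (pairing \<pi> (U (1 - t)) + pairing \<pi> (?S (U (1 - t)))) = pairing \<pi> (U (1 - t))"
        using total_pos[OF d, of \<pi>] unfolding coup[OF d] by simp
      then have "\<phi> (U (1 - t)) = 0" by (simp add: \<phi>_def algebra_simps)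
      then show ?thesis by (simp add: U_def R)
    qed
    moreover have "flux0 Q $ z \<le> 1" for z
      using chain_row_sum[of Q z] chain_nonneg(3)[of Q z]
        sum_nonneg[of UNIV "\<lambda>w. restricted_matrix Q $ z $ w"] chain_nonneg(1)[of Q z] by smt
    ultimately obtain r l where r: "\<phi> r = 0" "P *v r = l *\<^sub>R r" "\<And>z. r $ z > 0"
      using resolvent_orbit_eigenvector[OF sub irred chain_nonneg(2) _ flux0_nz] by blast
    have "?S r = sqrt K *\<^sub>R r"
      by (rule twist_positive_eigenvector[OF Pn irred rev K r(2,3)])
    then have "(1 - c - c * sqrt K) * pairing \<pi> r = 0"
      using r(1) by (simp add: \<phi>_def linear_scale[OF linear_pairing] algebra_simps)
    then have "1 - c - c * sqrt K = 0"
      using pairing_pos[OF r(3), of \<pi>] by (metis mult_eq_0_iff less_irrefl)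
    then have "c * (1 + sqrt K) = 1" by (simp add: algebra_simps)
    moreover have "1 + sqrt K > 0" using Kpos by (simp add: add_pos_pos)
    ultimately show ?thesis by (simp add: c_def field_simps)
  qed
  have bal_val: "coupling Q \<pi> \<gamma> = 1 / (1 + sqrt K)"
    if "balanced_pair \<sigma> \<kappa> z \<pi>" "\<gamma> \<in> {0<..<1}" for z \<pi> \<gamma>
  proof -
    have S: "pairing \<pi> (?S (U \<gamma>)) = sqrt K * pairing \<pi> (U \<gamma>)"
      by (rule balanced_pair_pairing_twist[OF inv pos K that(1)])
    then have "pairing \<pi> (U \<gamma>) \<noteq> 0" using total_pos[OF that(2), of \<pi>] by auto
    moreover have "coupling Q \<pi> \<gamma> = pairing \<pi> (U \<gamma>) / (pairing \<pi> (U \<gamma>) * (1 + sqrt K))"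
      by (simp add: coup[OF that(2)] S algebra_simps)
    ultimately show ?thesis by simp
  qed
  have ex: "\<exists>\<pi>. balanced_pair \<sigma> \<kappa> z \<pi>" for z by (rule balanced_pair_exists[OF pos])
  have bal_neutral: "reset_neutral Q \<pi>" if "balanced_pair \<sigma> \<kappa> z \<pi>" for z \<pi>
    using bal_val[OF that] by (simp add: reset_neutral_def)
  have "critical_value Q = 1 / (1 + sqrt K)"
    unfolding critical_value_def
  proof (rule the_equality)
    obtain \<pi> where "balanced_pair \<sigma> \<kappa> undefined \<pi>" using ex by blast
    then show "\<exists>\<pi>. reset_neutral Q \<pi> \<and> (\<forall>\<gamma>\<in>{0<..<1}. coupling Q \<pi> \<gamma> = 1 / (1 + sqrt K))"
      using bal_neutral bal_val by blast
  next
    fix c assume "\<exists>\<pi>. reset_neutral Q \<pi> \<and> (\<forall>\<gamma>\<in>{0<..<1}. coupling Q \<pi> \<gamma> = c)"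
    then obtain \<pi> where "reset_neutral Q \<pi>" "\<forall>\<gamma>\<in>{0<..<1}. coupling Q \<pi> \<gamma> = c" by blast
    moreover have "(1/2::real) \<in> {0<..<1}" by simp
    ultimately show "c = 1 / (1 + sqrt K)" using neutral_val by metis
  qed
  then show ?thesis using neutral_val ex bal_neutral by blast
qed

end
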